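(* Consider the one-dimensional Anderson model on a box $\Lambda\subset\mathbb{Z}$ of $N$ consecutive sites containing $0$: $(H_\omega u)(x)=u(x+1)+u(x-1)+\varepsilon_xu(x)$ with Dirichlet boundary conditions, $\{\varepsilon_x\}$ i.i.d. with bounded density $\rho$ supported in a bounded interval $[0,W]$. Let $(E_n,u_n)$ be the eigenvalues and real orthonormal eigenfunctions, $u_0$ an eigenfunction with $|u_0(0)|\ge N^{-1/2}$, and for $x,y\in\Lambda$ $$\frac{\partial u_0(x)}{\partial\varepsilon_y}=u_0(y)\sum_{n\ne0}\frac{u_n(x)u_n(y)}{E_0-E_n}.$$ Then there is a constant $B$, independent of $N$, $x$, $y$, such that $$\Big\langle\Big|\frac{\partial u_0(x)}{\partial\varepsilon_y}\Big|\Big\rangle\le BN^{11/2}$$ for all $N$ and $x,y\in\Lambda$.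
   Context: $\langle\cdot\rangle$ is expectation over the random potential. The displayed expression is the derivative of the normalized eigenfunction $u_0$ with respect to $\varepsilon_y$. *)

theory Defs
  imports "HOL-Probability.Probability"
begin

text \<open>The box of N consecutive sites is identified with {0..<N}; the paper's site 0
  corresponds to an index m < N. Vectors are functions nat => real read on {0..<N}.\<close>

definition anderson_H :: "nat \<Rightarrow> (nat \<Rightarrow> real) \<Rightarrow> (nat \<Rightarrow> real) \<Rightarrow> nat \<Rightarrow> real" where
  "anderson_H N eps u x =
     (if x + 1 < N then u (x + 1) else 0) + (if 0 < x then u (x - 1) else 0) + eps x * u x"

definition anderson_eigensystem ::
  "nat \<Rightarrow> (nat \<Rightarrow> real) \<Rightarrow> (nat \<Rightarrow> real) \<Rightarrow> (nat \<Rightarrow> nat \<Rightarrow> real) \<Rightarrow> bool" where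
  "anderson_eigensystem N eps E u \<longleftrightarrow>
     (\<forall>n<N. \<forall>x<N. anderson_H N eps (u n) x = E n * u n x) \<and>
     (\<forall>n<N. \<forall>n'<N. (\<Sum>x<N. u n x * u n' x) = (if n = n' then 1 else 0))"

text \<open>The derivative of u_k(x) with respect to eps_y, as given by the displayed formula.\<close>
definition deriv_u0 :: "nat \<Rightarrow> (nat \<Rightarrow> real) \<Rightarrow> (nat \<Rightarrow> nat \<Rightarrow> real) \<Rightarrow> nat \<Rightarrow> nat \<Rightarrow> nat \<Rightarrow> real" where
  "deriv_u0 N E u k x y = u k y * (\<Sum>n\<in>{..<N} - {k}. u n x * u n y / (E k - E n))"

definition anderson_measure :: "nat \<Rightarrow> (real \<Rightarrow> real) \<Rightarrow> (nat \<Rightarrow> real) measure" where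
  "anderson_measure N rho = PiM {..<N} (\<lambda>_. density lborel (\<lambda>t. ennreal (rho t)))"

end

theory Submission
  imports Defs
begin

text \<open>Freeze the potential off the site m. An energy E is an eigenvalue with u(m) nonzero
  exactly for one value t = g(E) of the potential at m, where g is a rational function not
  depending on that potential, and g'(E) = 1 / u(m)^2. So g is increasing between
  its at most N - 1 poles, and the hypothesis on u_0(m) says g'(E_0) <= N. By monotonicity a pole
  lies between E_0 and any other eigenvalue, hence the derivative is at most N / dist(E_0, poles).
  Since g' <= N also keeps E_0 exponentially (in N) away from the poles, the change of variables
  t = g(E) bounds the integral over t by a sum of at most 2(N - 1) integrals of N / |E - z|, each
  of order N^2. Integrating over the remaining sites gives the bound B N^4.\<close>

section \<open>Polynomials of the three-term recurrence\<close>

text \<open>Shifted by one: an eigenvector satisfies u(x) = u(0) rec_poly(x + 1), and index 0 stands for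
  the Dirichlet value at site -1.\<close>

fun rec_poly :: "(nat \<Rightarrow> real) \<Rightarrow> nat \<Rightarrow> real poly" where
  "rec_poly e 0 = 0"
| "rec_poly e (Suc 0) = 1"
| "rec_poly e (Suc (Suc n)) = [:- e n, 1:] * rec_poly e (Suc n) - rec_poly e n"

lemma rec_poly_cong:
  assumes "\<And>i. Suc i < n \<Longrightarrow> e i = e' i"
  shows "rec_poly e n = rec_poly e' n"
  using assms
proof (induction e n rule: rec_poly.induct)
  case (3 e n)
  have "rec_poly e (Suc n) = rec_poly e' (Suc n)" "rec_poly e n = rec_poly e' n" "e n = e' n"
    using 3 by auto
  then show ?case by simp
qed auto

lemma degree_rec_poly: "degree (rec_poly e n) \<le> n - 1 \<and> coeff (rec_poly e n) (n - 1) = (if n = 0 then 0 else 1)"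
proof (induction e n rule: rec_poly.induct)
  case (3 e n)
  have d: "degree ([:- e n, 1:] * rec_poly e (Suc n)) \<le> Suc n"
    using degree_mult_le[of "[:- e n, 1:]" "rec_poly e (Suc n)"] 3 by simp
  have "degree (rec_poly e n) < Suc n" using 3 by (auto split: if_splits)
  then have c0: "coeff (rec_poly e n) (Suc n) = 0" by (rule coeff_eq_0)
  have c1: "coeff (rec_poly e (Suc n)) (Suc n) = 0" using 3 by (intro coeff_eq_0) simp
  show ?case
    using d 3 c0 c1 by (auto intro!: degree_diff_le)
qed auto

lemma rec_poly_Suc_nonzero: "rec_poly e (Suc n) \<noteq> 0"
  using degree_rec_poly[of e "Suc n"] by auto

lemma card_roots_rec_poly: "card {z. poly (rec_poly e (Suc n)) z = 0} \<le> n"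
  using card_poly_roots_bound[OF rec_poly_Suc_nonzero, of e n] degree_rec_poly[of e "Suc n"] by simp

lemma poly_rec_poly_Suc: "poly (rec_poly e (Suc (Suc n))) E = (E - e n) * poly (rec_poly e (Suc n)) E - poly (rec_poly e n) E"
  by (simp add: algebra_simps)

lemma poly_pderiv_rec_poly_Suc:
  "poly (pderiv (rec_poly e (Suc (Suc n)))) E =
    poly (rec_poly e (Suc n)) E + (E - e n) * poly (pderiv (rec_poly e (Suc n))) E - poly (pderiv (rec_poly e n)) E"
proof -
  have "pderiv [:- e n, 1:] = 1" by (simp add: pderiv_pCons)
  then show ?thesis
    unfolding rec_poly.simps pderiv_diff pderiv_mult by (simp add: algebra_simps del: mult_pCons_left)
qed

declare rec_poly.simps(3) [simp del]

text \<open>The left side is a Wronskian in the energy. By the recurrence, raising n by one adds the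
  square of \<open>poly (rec_poly e (Suc n)) E\<close>. It fixes the sign of the derivative of the
  quotients in \<open>coupling\<close>.\<close>

lemma christoffel_darboux:
  "poly (pderiv (rec_poly e (Suc n))) E * poly (rec_poly e n) E - poly (rec_poly e (Suc n)) E * poly (pderiv (rec_poly e n)) E
    = (\<Sum>i<n. (poly (rec_poly e (Suc i)) E)\<^sup>2)"
  by (induction n) (simp_all add: poly_rec_poly_Suc poly_pderiv_rec_poly_Suc algebra_simps power2_eq_square)

text \<open>In each recursion step the factor is at most K - 1, and the 1 left over absorbs the
  second-order term. The doubled base pays for the extra term produced by differentiation, through K
  + 1 \<le> 2 * K. A crude exponential rate suffices, because it later enters only through a
  logarithm.\<close>

lemma pderiv_rec_poly_le:
  assumes "\<And>i. Suc i < n \<Longrightarrow> \<bar>E - e i\<bar> + 1 \<le> K" and "1 \<le> K"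
  shows "\<bar>poly (rec_poly e n) E\<bar> \<le> K ^ n \<and> \<bar>poly (pderiv (rec_poly e n)) E\<bar> \<le> (2 * K) ^ n"
  using assms
proof (induction e n rule: rec_poly.induct)
  case (3 e n)
  let ?q = "\<lambda>i. poly (rec_poly e i) E" and ?d = "\<lambda>i. poly (pderiv (rec_poly e i)) E"
  have q1: "\<bar>?q (Suc n)\<bar> \<le> K ^ Suc n" "\<bar>?d (Suc n)\<bar> \<le> (2 * K) ^ Suc n"
    and q0: "\<bar>?q n\<bar> \<le> K ^ n" "\<bar>?d n\<bar> \<le> (2 * K) ^ n"
    using 3 by auto
  have e: "\<bar>E - e n\<bar> \<le> K - 1" using 3(3)[of n] by simp
  have q: "?q (Suc (Suc n)) = (E - e n) * ?q (Suc n) - ?q n" by (rule poly_rec_poly_Suc)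
  have d: "?d (Suc (Suc n)) = ?q (Suc n) + (E - e n) * ?d (Suc n) - ?d n"
    by (rule poly_pderiv_rec_poly_Suc)
  have m: "K ^ n \<le> K ^ Suc n" "(2 * K) ^ n \<le> (2 * K) ^ Suc n" "K ^ Suc n \<le> (2 * K) ^ Suc n"
    using \<open>1 \<le> K\<close> by (intro power_increasing power_mono; simp)+
  have p: "\<bar>(E - e n) * ?q (Suc n)\<bar> \<le> (K - 1) * K ^ Suc n"
    unfolding abs_mult using e q1 \<open>1 \<le> K\<close> by (intro mult_mono) auto
  have p': "\<bar>(E - e n) * ?d (Suc n)\<bar> \<le> (K - 1) * (2 * K) ^ Suc n"
    unfolding abs_mult using e q1 \<open>1 \<le> K\<close> by (intro mult_mono) auto
  have "\<bar>?q (Suc (Suc n))\<bar> \<le> (K - 1) * K ^ Suc n + K ^ Suc n"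
    unfolding q using p q0 m by linarith
  moreover have "\<bar>?d (Suc (Suc n))\<bar> \<le> (2 * K) ^ Suc n + (K - 1) * (2 * K) ^ Suc n + (2 * K) ^ Suc n"
    unfolding d using p' q0 q1 m by linarith
  moreover have "\<dots> \<le> (2 * K) * (2 * K) ^ Suc n"
  proof -
    have "(2 * K) ^ Suc n + (K - 1) * (2 * K) ^ Suc n + (2 * K) ^ Suc n = (K + 1) * (2 * K) ^ Suc n"
      by (simp add: algebra_simps)
    also have "\<dots> \<le> (2 * K) * (2 * K) ^ Suc n"
      using \<open>1 \<le> K\<close> by (intro mult_right_mono) auto
    finally show ?thesis .
  qed
  ultimately show ?case by (simp add: algebra_simps)
qed auto

section \<open>Eigenvectors and eigenvalues of the box\<close>

text \<open>Each row of the eigenvalue equation determines the next value from the two before it, so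
  \<open>u 0\<close> fixes the whole vector.\<close>

lemma eigenvector_eq_rec_poly:
  assumes "\<And>x. x < N \<Longrightarrow> anderson_H N e u x = E * u x" and "x < N"
  shows "u x = u 0 * poly (rec_poly e (Suc x)) E"
  using assms(2)
proof (induction x rule: less_induct)
  case (less x)
  consider "x = 0" | "x = 1" | n where "x = Suc (Suc n)"
    by (cases x) (auto, metis One_nat_def nat.exhaust)
  then show ?case
  proof cases
    case 2
    then show ?thesis using assms(1)[of 0] less.prems
      by (simp add: anderson_H_def poly_rec_poly_Suc[of e 0, simplified] algebra_simps)
  next
    case (3 n)
    have "u (Suc n) = u 0 * poly (rec_poly e (Suc (Suc n))) E" "u n = u 0 * poly (rec_poly e (Suc n)) E"
      using less.IH[of "Suc n"] less.IH[of n] less.prems 3 by simp_all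
    moreover have "u x = (E - e (Suc n)) * u (Suc n) - u n"
      using assms(1)[of "Suc n"] less.prems 3 by (simp add: anderson_H_def algebra_simps)
    ultimately have "u x = u 0 * poly (rec_poly e (Suc (Suc (Suc n)))) E"
      unfolding poly_rec_poly_Suc[of e "Suc n"] by (simp add: algebra_simps)
    then show ?thesis using 3 by simp
  qed simp
qed

text \<open>Reflection turns the recursion from the right end into one from the left end, so
  \<open>eigenvector_eq_rec_poly\<close> serves both sides of m.\<close>

lemma anderson_H_reflect:
  assumes "x < N"
  shows "anderson_H N (\<lambda>i. e (N - 1 - i)) (\<lambda>i. u (N - 1 - i)) x = anderson_H N e u (N - 1 - x)"
proof -
  have "0 < x \<Longrightarrow> N - 1 - (x - 1) = N - 1 - x + 1" using assms by simp
  then show ?thesis using assms by (auto simp: anderson_H_def)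
qed

text \<open>Read the equation at a site where |u| is maximal: relative to that maximum the
  neighbours contribute at most 2 and the potential at most W.\<close>

lemma eigenvalue_abs_le:
  assumes H: "\<And>x. x < N \<Longrightarrow> anderson_H N e u x = E * u x"
    and "(\<Sum>x<N. (u x)\<^sup>2) = 1" and e: "\<And>x. x < N \<Longrightarrow> \<bar>e x\<bar> \<le> W"
  shows "\<bar>E\<bar> \<le> W + 2"
proof -
  have "{..<N} \<noteq> {}" using assms(2) by (intro notI) simp
  then have "Max ((\<lambda>x. \<bar>u x\<bar>) ` {..<N}) \<in> (\<lambda>x. \<bar>u x\<bar>) ` {..<N}" by (intro Max_in) auto
  then obtain x where x: "x < N" "\<bar>u x\<bar> = Max ((\<lambda>x. \<bar>u x\<bar>) ` {..<N})" by auto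
  have mx: "\<bar>u y\<bar> \<le> \<bar>u x\<bar>" if "y < N" for y
    unfolding x(2) using that by (intro Max_ge) auto
  have pos: "\<bar>u x\<bar> > 0"
  proof (rule ccontr)
    assume "\<not> ?thesis"
    then have "u y = 0" if "y < N" for y using mx[OF that] by simp
    then show False using assms(2) by simp
  qed
  define a where "a = (if x + 1 < N then u (x + 1) else 0)"
  define b where "b = (if 0 < x then u (x - 1) else 0)"
  have "\<bar>a\<bar> \<le> \<bar>u x\<bar>" "\<bar>b\<bar> \<le> \<bar>u x\<bar>" using mx x(1) by (auto simp: a_def b_def)
  moreover have "\<bar>e x * u x\<bar> \<le> W * \<bar>u x\<bar>"
    unfolding abs_mult using e[OF x(1)] by (intro mult_right_mono) auto
  moreover have "E * u x = a + b + e x * u x"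
    using H[OF x(1)] by (simp add: anderson_H_def a_def b_def)
  ultimately have "\<bar>E * u x\<bar> \<le> (W + 2) * \<bar>u x\<bar>" by (simp add: algebra_simps)
  then show ?thesis using pos by (simp add: abs_mult)
qed

section \<open>Integral inequalities and a change of variables\<close>

text \<open>No measurability of f is assumed: \<^const>\<open>nn_integral\<close> is then a lower integral, and the
  Tonelli inequality in this direction follows from its simple minorants. This is needed because the
  choice of the eigensystem may be non-measurable.\<close>

lemma nn_integral_PiM_fiber_le:
  fixes f :: "('i \<Rightarrow> 'a) \<Rightarrow> ennreal"
  assumes "prob_space M" "finite J" "i \<notin> J" and AE_P: "AE t in M. P t"
    and le: "\<And>w. w \<in> space (PiM J (\<lambda>_. M)) \<Longrightarrow> (\<forall>j\<in>J. P (w j)) \<Longrightarrow> (\<integral>\<^sup>+t. f (w(i := t)) \<partial>M) \<le> B"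
  shows "(\<integral>\<^sup>+w. f w \<partial>PiM (insert i J) (\<lambda>_. M)) \<le> B"
proof -
  interpret M: prob_space M by fact
  interpret product_prob_space "\<lambda>_. M" by standard
  have AE_J: "AE w in PiM J (\<lambda>_. M). \<forall>j\<in>J. P (w j)"
    using AE_PiM_component[of J "\<lambda>_. M", OF M.prob_space_axioms _ AE_P] \<open>finite J\<close>
    by (simp add: AE_finite_all)
  show ?thesis
    unfolding nn_integral_def
  proof (rule SUP_least, clarify)
    fix g :: "('i \<Rightarrow> 'a) \<Rightarrow> ennreal"
    assume g: "simple_function (PiM (insert i J) (\<lambda>_. M)) g" and "g \<le> f"
    have "integral\<^sup>S (PiM (insert i J) (\<lambda>_. M)) g = (\<integral>\<^sup>+w. (\<integral>\<^sup>+t. g (w(i := t)) \<partial>M) \<partial>PiM J (\<lambda>_. M))"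
      using assms(2,3) g
      by (simp add: nn_integral_eq_simple_integral[symmetric] product_nn_integral_insert
          borel_measurable_simple_function)
    also have "\<dots> \<le> (\<integral>\<^sup>+w. B \<partial>PiM J (\<lambda>_. M))"
    proof (rule nn_integral_mono_AE)
      show "AE w in PiM J (\<lambda>_. M). (\<integral>\<^sup>+t. g (w(i := t)) \<partial>M) \<le> B"
        using AE_J AE_space
      proof eventually_elim
        case (elim w)
        have "(\<integral>\<^sup>+t. g (w(i := t)) \<partial>M) \<le> (\<integral>\<^sup>+t. f (w(i := t)) \<partial>M)"
          using \<open>g \<le> f\<close> by (intro nn_integral_mono) (auto simp: le_fun_def)
        also have "\<dots> \<le> B" using le elim by blast
        finally show ?case .
      qed
    qed
    also have "\<dots> = B"
      by (simp add: prob_space.emeasure_space_1[OF prob_space_axioms] prob_space.emeasure_space_1 prob_space_PiM M.prob_space_axioms)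
    finally show "integral\<^sup>S (PiM (insert i J) (\<lambda>_. M)) g \<le> B" .
  qed
qed

text \<open>As above, f may fail to be measurable, so the density formula is applied to its simple
  minorants before taking the supremum.\<close>

lemma nn_integral_density_le:
  assumes [measurable]: "r \<in> borel_measurable M"
  shows "integral\<^sup>N (density M r) f \<le> (\<integral>\<^sup>+x. r x * f x \<partial>M)"
  unfolding nn_integral_def[of "density M r"]
proof (rule SUP_least, clarify)
  fix g :: "'a \<Rightarrow> ennreal" assume g: "simple_function (density M r) g" "g \<le> f"
  have [measurable]: "g \<in> borel_measurable M"
    using borel_measurable_simple_function[OF g(1)] by simp
  have "integral\<^sup>S (density M r) g = (\<integral>\<^sup>+x. r x * g x \<partial>M)"
    using g(1) by (simp add: nn_integral_eq_simple_integral[symmetric] nn_integral_density)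
  also have "\<dots> \<le> (\<integral>\<^sup>+x. r x * f x \<partial>M)"
    using g(2) by (intro nn_integral_mono mult_left_mono) (auto simp: le_fun_def)
  finally show "integral\<^sup>S (density M r) g \<le> (\<integral>\<^sup>+x. r x * f x \<partial>M)" .
qed

text \<open>With the cut-off \<eta> the singularity costs only a logarithm, so an exponentially
  small \<eta> still leads to a polynomial bound.\<close>

lemma has_integral_inverse_dist:
  fixes z \<eta> :: real
  assumes "0 < \<eta>" "\<eta> \<le> 1" and I: "I = {z + \<eta>..z + 1} \<or> I = {z - 1..z - \<eta>}"
  shows "((\<lambda>x. 1 / \<bar>x - z\<bar>) has_integral ln (1 / \<eta>)) I"
  using I
proof
  assume I: "I = {z + \<eta>..z + 1}"
  have "((\<lambda>x. 1 / \<bar>x - z\<bar>) has_integral (ln (z + 1 - z) - ln (z + \<eta> - z))) {z + \<eta>..z + 1}"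
    using assms by (intro fundamental_theorem_of_calculus)
      (auto intro!: derivative_eq_intros simp flip: has_real_derivative_iff_has_vector_derivative)
  then show ?thesis using I assms by (simp add: ln_div)
next
  assume I: "I = {z - 1..z - \<eta>}"
  have "((\<lambda>x. 1 / \<bar>x - z\<bar>) has_integral (- ln (z - (z - \<eta>)) - - ln (z - (z - 1)))) {z - 1..z - \<eta>}"
    using assms by (intro fundamental_theorem_of_calculus)
      (auto intro!: derivative_eq_intros simp: field_simps simp flip: has_real_derivative_iff_has_vector_derivative)
  then show ?thesis using I assms by (simp add: ln_div)
qed

text \<open>Substituting t = g x turns the integral over the image into one of |g' x| / |x - z| over
  S, where \<open>has_integral_inverse_dist\<close> applies. The change of variables yields Lebesgue
  measurability of h, hence \<open>lebesgue\<close> in place of \<open>lborel\<close>.\<close>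

lemma nn_integral_inverse_dist_image:
  fixes g g' :: "real \<Rightarrow> real"
  assumes S: "S \<in> sets borel" and g'[measurable]: "g' \<in> borel_measurable borel"
    and der: "\<And>x. x \<in> S \<Longrightarrow> (g has_real_derivative g' x) (at x)" and inj: "inj_on g S"
    and L: "\<And>x. x \<in> S \<Longrightarrow> \<bar>g' x\<bar> \<le> L" "0 \<le> L"
    and "0 < \<eta>" "\<eta> \<le> 1" and SI: "S \<subseteq> I" and I: "I = {z + \<eta>..z + 1} \<or> I = {z - 1..z - \<eta>}"
  defines "h \<equiv> \<lambda>t. indicator (g ` S) t * (1 / \<bar>inv_into S g t - z\<bar>)"
  shows "h \<in> borel_measurable lebesgue" "(\<integral>\<^sup>+t. ennreal (h t) \<partial>lebesgue) \<le> ennreal (L * ln (1 / \<eta>))"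
proof -
  let ?\<phi> = "\<lambda>t. 1 / \<bar>inv_into S g t - z\<bar>"
  let ?G = "\<lambda>x. L * (1 / \<bar>x - z\<bar>)"
  have S': "S \<in> sets lebesgue" using S by simp
  have GI: "(?G has_integral L * ln (1 / \<eta>)) I"
    using has_integral_inverse_dist[OF assms(7,8) I] by (rule has_integral_mult_right)
  have "?G absolutely_integrable_on I"
    using GI L by (intro nonnegative_absolutely_integrable_1) auto
  then have Gabs: "?G absolutely_integrable_on S"
    using S' SI by (rule set_integrable_subset)
  then have GS: "?G integrable_on S" by (rule absolutely_integrable_on_def[THEN iffD1, THEN conjunct1])
  \<comment> \<open>Domination by L / |x - z| gives integrability over S, which the change of
    variables carries to the image.\<close>
  have kabs: "(\<lambda>x. \<bar>g' x\<bar> * (1 / \<bar>x - z\<bar>)) absolutely_integrable_on S"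
  proof (rule measurable_bounded_by_integrable_imp_absolutely_integrable[OF _ S' GS])
    have "(\<lambda>x. \<bar>g' x\<bar> * (1 / \<bar>x - z\<bar>)) \<in> borel_measurable borel" by measurable
    then show "(\<lambda>x. \<bar>g' x\<bar> * (1 / \<bar>x - z\<bar>)) \<in> borel_measurable (lebesgue_on S)"
      by (intro measurable_restrict_space1 borel_measurable_if_D) (simp add: measurable_completion)
  qed (use L in \<open>auto simp: abs_mult intro!: divide_right_mono\<close>)
  have eq: "\<bar>g' x\<bar> * ?\<phi> (g x) = \<bar>g' x\<bar> * (1 / \<bar>x - z\<bar>)" if "x \<in> S" for x
    using inj that by simp
  have kabs': "(\<lambda>x. \<bar>g' x\<bar> * ?\<phi> (g x)) absolutely_integrable_on S"
    using kabs by (rule absolutely_integrable_spike[OF _ negligible_empty]) (use eq in auto)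
  have "?\<phi> absolutely_integrable_on g ` S \<and>
      integral (g ` S) ?\<phi> = integral S (\<lambda>x. \<bar>g' x\<bar> * ?\<phi> (g x))"
    using has_absolute_integral_change_of_variables_1'[OF S' _ inj, of g' ?\<phi>] der kabs'
    by (blast intro: has_field_derivative_at_within)
  then have \<phi>: "?\<phi> absolutely_integrable_on g ` S" 
      "integral (g ` S) ?\<phi> = integral S (\<lambda>x. \<bar>g' x\<bar> * ?\<phi> (g x))" by auto
  have "integral S (\<lambda>x. \<bar>g' x\<bar> * ?\<phi> (g x)) \<le> integral S ?G"
  proof (rule integral_le)
    show "\<bar>g' x\<bar> * ?\<phi> (g x) \<le> ?G x" if "x \<in> S" for x
      unfolding eq[OF that] using L(1)[OF that] by (intro mult_right_mono) auto
  qed (use kabs' GS in \<open>auto simp: absolutely_integrable_on_def\<close>)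
  also have "\<dots> \<le> integral I ?G"
    using GS GI SI L by (intro integral_subset_le) auto
  also have "\<dots> = L * ln (1 / \<eta>)" using GI by (rule integral_unique)
  finally have le: "integral (g ` S) ?\<phi> \<le> L * ln (1 / \<eta>)" using \<phi> by simp
  have hint: "integrable lebesgue h"
    using \<phi>(1) by (simp add: set_integrable_def h_def)
  then show "h \<in> borel_measurable lebesgue" by auto
  have "(\<integral>\<^sup>+t. ennreal (h t) \<partial>lebesgue) = ennreal (\<integral>t. h t \<partial>lebesgue)"
    using hint by (intro nn_integral_eq_integral) (auto simp: h_def)
  also have "(\<integral>t. h t \<partial>lebesgue) = integral (g ` S) ?\<phi>"
    using set_lebesgue_integral_eq_integral(2)[OF \<phi>(1)]
    by (simp add: set_lebesgue_integral_def h_def)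
  finally show "(\<integral>\<^sup>+t. ennreal (h t) \<partial>lebesgue) \<le> ennreal (L * ln (1 / \<eta>))"
    using le by (simp add: ennreal_leI)
qed

section \<open>The derivative and the spectral gap\<close>

lemma abs_le_1_of_sum_squares:
  fixes v :: "nat \<Rightarrow> real"
  assumes "(\<Sum>x<N. (v x)\<^sup>2) = 1" "x < N"
  shows "\<bar>v x\<bar> \<le> 1"
proof -
  have "(v x)\<^sup>2 \<le> (\<Sum>x<N. (v x)\<^sup>2)" using assms(2) by (intro member_le_sum) auto
  then show ?thesis using assms(1) by (simp add: abs_square_le_1)
qed

text \<open>Entries of unit vectors are at most 1 in modulus, so each of the at most N summands is
  at most 1 / d, and so is the effect of the prefactor \<open>u k y\<close> at most a factor
  1.\<close>

lemma abs_deriv_u0_le: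
  assumes norm: "\<And>n. n < N \<Longrightarrow> (\<Sum>x<N. (u n x)\<^sup>2) = 1"
    and gap: "\<And>n. n < N \<Longrightarrow> E n \<noteq> E k \<Longrightarrow> d \<le> \<bar>E k - E n\<bar>"
    and "0 < d" "k < N" "x < N" "y < N"
  shows "\<bar>deriv_u0 N E u k x y\<bar> \<le> N * (1 / d)"
proof -
  have le1: "\<bar>u n x\<bar> \<le> 1" if "n < N" "x < N" for n x
    using abs_le_1_of_sum_squares norm that by blast
  have "\<bar>u n x * u n y / (E k - E n)\<bar> \<le> 1 / d" if "n < N" for n
  proof (cases "E n = E k")
    case False
    have "\<bar>u n x\<bar> * \<bar>u n y\<bar> \<le> 1 * 1" using le1 that assms by (intro mult_mono) auto
    moreover have "d \<le> \<bar>E k - E n\<bar>" using gap that False by blast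
    ultimately show ?thesis
      unfolding abs_divide abs_mult using \<open>0 < d\<close> by (intro frac_le) auto
  \<comment> \<open>For E n = E k the denominator is 0 and HOL sets the quotient to 0, so degenerate
    eigenvalues cause no trouble.\<close>
  qed (use \<open>0 < d\<close> in simp)
  then have "(\<Sum>n\<in>{..<N} - {k}. \<bar>u n x * u n y / (E k - E n)\<bar>) \<le> card ({..<N} - {k}) * (1 / d)"
    by (intro sum_bounded_above) auto
  also have "\<dots> \<le> N * (1 / d)"
    using \<open>0 < d\<close> \<open>k < N\<close> by (intro mult_right_mono) auto
  finally have "\<bar>\<Sum>n\<in>{..<N} - {k}. u n x * u n y / (E k - E n)\<bar> \<le> N * (1 / d)"
    using sum_abs by (rule order_trans[rotated])
  then have "\<bar>u k y\<bar> * \<bar>\<Sum>n\<in>{..<N} - {k}. u n x * u n y / (E k - E n)\<bar> \<le> 1 * (N * (1 / d))"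
    using le1 assms by (intro mult_mono) auto
  then show ?thesis by (simp add: deriv_u0_def abs_mult)
qed

section \<open>Varying the potential at one site\<close>

locale anderson_site =
  fixes N m :: nat and e :: "nat \<Rightarrow> real"
  assumes m: "m < N"
begin

definition e_rev :: "nat \<Rightarrow> real" where "e_rev i = e (N - 1 - i)"

text \<open>The eigenvalues of the two half boxes obtained by deleting the site m.\<close>

definition poles :: "real set" where
  "poles = {z. poly (rec_poly e (Suc m)) z = 0} \<union> {z. poly (rec_poly e_rev (Suc (N - 1 - m))) z = 0}"

text \<open>Row m of the eigenvalue equation solved for the potential there. The two quotients are
  the diagonal resolvent entries of the half boxes at the neighbours of m; for an empty half box the
  quotient is 0 because \<open>rec_poly\<close> vanishes at index 0.\<close>

definition coupling :: "real \<Rightarrow> real" where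
  "coupling E = E - poly (rec_poly e m) E / poly (rec_poly e (Suc m)) E
           - poly (rec_poly e_rev (N - 1 - m)) E / poly (rec_poly e_rev (Suc (N - 1 - m))) E"

text \<open>The squared norm of the function glued from the two end solutions and normalised to 1 at
  m.\<close>

definition coupling_deriv :: "real \<Rightarrow> real" where
  "coupling_deriv E = 1 + (\<Sum>i<m. (poly (rec_poly e (Suc i)) E)\<^sup>2) / (poly (rec_poly e (Suc m)) E)\<^sup>2
            + (\<Sum>i<N - 1 - m. (poly (rec_poly e_rev (Suc i)) E)\<^sup>2) / (poly (rec_poly e_rev (Suc (N - 1 - m))) E)\<^sup>2"

definition eigenpair :: "real \<Rightarrow> real \<Rightarrow> (nat \<Rightarrow> real) \<Rightarrow> bool" where
  "eigenpair t E v \<longleftrightarrow>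
     (\<forall>x<N. anderson_H N (e(m := t)) v x = E * v x) \<and> (\<Sum>x<N. (v x)\<^sup>2) = 1"

lemma finite_poles: "finite poles"
  by (simp add: poles_def poly_roots_finite rec_poly_Suc_nonzero)

lemma card_poles: "card poles \<le> N"
proof -
  have "card poles \<le> m + (N - 1 - m)"
    unfolding poles_def using card_roots_rec_poly by (intro order_trans[OF card_Un_le] add_mono)
  then show ?thesis using m by simp
qed

lemma coupling_deriv_measurable [measurable]: "coupling_deriv \<in> borel_measurable borel"
proof -
  have "(\<lambda>x. poly p x) \<in> borel_measurable borel" for p :: "real poly"
    by (intro borel_measurable_continuous_onI continuous_intros)
  note [measurable] = this
  show ?thesis unfolding coupling_deriv_def[abs_def] by measurable
qed

lemma coupling_deriv_ge_1: "1 \<le> coupling_deriv E"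
  by (simp add: coupling_deriv_def sum_nonneg)

text \<open>The quotient rule leaves, up to sign, the left side of
  \<open>christoffel_darboux\<close> in each numerator.\<close>

lemma has_derivative_coupling:
  assumes "E \<notin> poles"
  shows "(coupling has_real_derivative coupling_deriv E) (at E)"
proof -
  have quot: "((\<lambda>E. poly (rec_poly e n) E / poly (rec_poly e (Suc n)) E) has_real_derivative
      - ((\<Sum>i<n. (poly (rec_poly e (Suc i)) E)\<^sup>2) / (poly (rec_poly e (Suc n)) E)\<^sup>2)) (at E)"
    if "poly (rec_poly e (Suc n)) E \<noteq> 0" for n e
    using that unfolding christoffel_darboux[symmetric]
    by (auto intro!: derivative_eq_intros simp: power2_eq_square minus_divide_left algebra_simps)
  show ?thesis
    using DERIV_diff[OF DERIV_diff[OF DERIV_ident quot[of e m]] quot[of e_rev "N - 1 - m"]] assms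
    by (simp add: coupling_def[abs_def] coupling_deriv_def poles_def)
qed

lemma coupling_strict_mono:
  assumes "a < b" "{a..b} \<inter> poles = {}"
  shows "coupling a < coupling b"
proof (rule DERIV_pos_imp_increasing[OF assms(1)])
  fix x assume "a \<le> x" "x \<le> b"
  then have "x \<notin> poles" using assms(2) by auto
  then show "\<exists>y. (coupling has_real_derivative y) (at x) \<and> y > 0"
    using has_derivative_coupling coupling_deriv_ge_1[of x] by fastforce
qed

context
  fixes t E v assumes eig: "eigenpair t E v"
begin

text \<open>Up to index m + 1 the recursion reads the potential only left of m, so t drops
  out.\<close>

lemma eigenpair_left:
  assumes "x \<le> m"
  shows "v x = v 0 * poly (rec_poly e (Suc x)) E"
proof -
  have "v x = v 0 * poly (rec_poly (e(m := t)) (Suc x)) E"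
    using eig m assms by (intro eigenvector_eq_rec_poly[where N = N]) (auto simp: eigenpair_def simp del: fun_upd_apply)
  also have "rec_poly (e(m := t)) (Suc x) = rec_poly e (Suc x)"
    using assms by (intro rec_poly_cong) auto
  finally show ?thesis .
qed

lemma eigenpair_right:
  assumes "x \<le> N - 1 - m"
  shows "v (N - 1 - x) = v (N - 1) * poly (rec_poly e_rev (Suc x)) E"
proof -
  let ?v = "\<lambda>i. v (N - 1 - i)" and ?e = "\<lambda>i. (e(m := t)) (N - 1 - i)"
  have "?v x = ?v 0 * poly (rec_poly ?e (Suc x)) E"
  proof (rule eigenvector_eq_rec_poly)
    show "anderson_H N ?e ?v i = E * ?v i" if "i < N" for i
      using anderson_H_reflect[OF that, of "e(m := t)" v] eig that by (simp add: eigenpair_def)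
  qed (use assms m in simp)
  also have "rec_poly ?e (Suc x) = rec_poly e_rev (Suc x)"
    using assms by (intro rec_poly_cong) (auto simp: e_rev_def)
  finally show ?thesis by simp
qed

lemma eigenpair_center:
  "v m = v 0 * poly (rec_poly e (Suc m)) E" "v m = v (N - 1) * poly (rec_poly e_rev (Suc (N - 1 - m))) E"
  using eigenpair_left[of m] eigenpair_right[of "N - 1 - m"] m by auto

lemma eigenpair_sum_squares:
  "(v m)\<^sup>2 + (\<Sum>i<m. (v i)\<^sup>2) + (\<Sum>i<N - 1 - m. (v (N - 1 - i))\<^sup>2) = 1"
proof -
  have "(\<Sum>i<N - 1 - m. (v (N - 1 - i))\<^sup>2) = (\<Sum>x\<in>{m<..<N}. (v x)\<^sup>2)"
    by (rule sum.reindex_bij_witness[of _ "\<lambda>x. N - 1 - x" "\<lambda>x. N - 1 - x"]) auto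
  moreover have "(\<Sum>x<N. (v x)\<^sup>2) = (\<Sum>x\<in>insert m ({..<m} \<union> {m<..<N}). (v x)\<^sup>2)"
    using m by (intro sum.cong) auto
  moreover have "\<dots> = (v m)\<^sup>2 + ((\<Sum>i<m. (v i)\<^sup>2) + (\<Sum>x\<in>{m<..<N}. (v x)\<^sup>2))"
    by (subst sum.insert, simp, simp, subst sum.union_disjoint) auto
  ultimately show ?thesis using eig by (simp add: eigenpair_def)
qed

text \<open>If \<open>v m\<close> were 0, then away from the poles both end values would vanish by
  \<open>eigenpair_center\<close>, and with them all of v, against the normalisation.\<close>

lemma eigenpair_center_nonzero:
  assumes "E \<notin> poles"
  shows "v m \<noteq> 0"
proof
  assume "v m = 0"
  then have 0: "v 0 = 0" "v (N - 1) = 0"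
    using eigenpair_center assms by (auto simp: poles_def)
  have "v i = 0" if "i < m" for i
    using eigenpair_left[of i] 0 that by simp
  moreover have "v (N - 1 - i) = 0" if "i < N - 1 - m" for i
    using eigenpair_right[of i] 0 that by simp
  ultimately show False using eigenpair_sum_squares \<open>v m = 0\<close> by simp
qed

text \<open>Row m divided by \<open>v m\<close> gives the second claim; the normalisation divided by
  the square of \<open>v m\<close> gives the third.\<close>

lemma eigenpair_coupling:
  assumes v: "v m \<noteq> 0"
  shows "E \<notin> poles" "coupling E = t" "coupling_deriv E = 1 / (v m)\<^sup>2"
proof -
  let ?l = "poly (rec_poly e (Suc m)) E" and ?r = "poly (rec_poly e_rev (Suc (N - 1 - m))) E"
  have nz: "v 0 \<noteq> 0" "?l \<noteq> 0" "v (N - 1) \<noteq> 0" "?r \<noteq> 0"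
    using v eigenpair_center by auto
  then show "E \<notin> poles" by (simp add: poles_def)
  have v0: "v 0 = v m / ?l" "v (N - 1) = v m / ?r"
    using eigenpair_center nz by (simp_all add: field_simps)
  \<comment> \<open>At an end of the box the missing neighbour matches \<open>rec_poly\<close> at
    index 0, which is 0.\<close>
  have "(if 0 < m then v (m - 1) else 0) = v 0 * poly (rec_poly e m) E"
    using eigenpair_left[of "m - 1"] by auto
  moreover have "(if m + 1 < N then v (m + 1) else 0) = v (N - 1) * poly (rec_poly e_rev (N - 1 - m)) E"
  proof (cases "m + 1 < N")
    case True
    then have "Suc (N - 2 - m) = N - 1 - m" "N - 1 - (N - 2 - m) = m + 1" by auto
    then show ?thesis using eigenpair_right[of "N - 2 - m"] True by simp
  next
    case False
    then have "N - 1 - m = 0" by simp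
    then show ?thesis using False by simp
  qed
  moreover have "anderson_H N (e(m := t)) v m = E * v m"
    using eig m by (simp add: eigenpair_def)
  ultimately have "v (N - 1) * poly (rec_poly e_rev (N - 1 - m)) E + v 0 * poly (rec_poly e m) E + t * v m = E * v m"
    by (simp add: anderson_H_def)
  then have "v m * (poly (rec_poly e_rev (N - 1 - m)) E / ?r + poly (rec_poly e m) E / ?l + t) = v m * E"
    unfolding v0 by (simp add: algebra_simps)
  then show "coupling E = t" using v by (simp add: coupling_def)
  have "(v i)\<^sup>2 = (v m / ?l)\<^sup>2 * (poly (rec_poly e (Suc i)) E)\<^sup>2" if "i < m" for i
    using eigenpair_left[of i] that unfolding v0 power_mult_distrib[symmetric] by simp
  moreover have "(v (N - 1 - i))\<^sup>2 = (v m / ?r)\<^sup>2 * (poly (rec_poly e_rev (Suc i)) E)\<^sup>2"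
    if "i < N - 1 - m" for i
    using eigenpair_right[of i] that unfolding v0 power_mult_distrib[symmetric] by simp
  ultimately have "(v m)\<^sup>2 * coupling_deriv E = 1"
    using eigenpair_sum_squares
    by (simp add: coupling_deriv_def sum_distrib_left sum_divide_distrib power_divide algebra_simps)
  then show "coupling_deriv E = 1 / (v m)\<^sup>2" using v by (simp add: field_simps)
qed

end

section \<open>Distance from an eigenvalue to the poles\<close>

text \<open>If E' is no pole, both energies have the same \<open>coupling\<close> value t, so strict
  monotonicity forces a pole between them; otherwise z = E' serves.\<close>

lemma eigenpair_separation:
  assumes "eigenpair t E v" "eigenpair t E' v'" "v m \<noteq> 0" "E \<noteq> E'"
  shows "\<exists>z\<in>poles. \<bar>E - z\<bar> \<le> \<bar>E - E'\<bar>"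
proof (rule ccontr)
  assume *: "\<not> ?thesis"
  then have "E' \<notin> poles" by auto
  then have "v' m \<noteq> 0" using assms(2) by (rule eigenpair_center_nonzero[rotated])
  then have eq: "coupling E = coupling E'" using eigenpair_coupling(2) assms by metis
  have "{min E E'..max E E'} \<inter> poles = {}"
    using * by (force simp: min_def max_def abs_if split: if_splits)
  then have "coupling (min E E') < coupling (max E E')"
    using assms(4) by (intro coupling_strict_mono) auto
  then show False using eq by (simp add: min_def max_def split: if_splits)
qed

text \<open>The term i = 0 of the sum has numerator 1, so a small denominator would make
  \<open>coupling_deriv\<close> exceed N. The resulting bound N^(-1/2) is weakened to 1 / N.\<close>

lemma coupling_deriv_root_bound:
  assumes "z \<in> poles" "E \<notin> poles" "coupling_deriv E \<le> N"
  obtains e' n where "n < N" "e' = e \<and> n = m \<or> e' = e_rev \<and> n = N - 1 - m"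
    "poly (rec_poly e' (Suc n)) z = 0" "1 / N \<le> \<bar>poly (rec_poly e' (Suc n)) E\<bar>"
proof -
  let ?s = "\<lambda>e' n. (\<Sum>i<n. (poly (rec_poly e' (Suc i)) E)\<^sup>2) / (poly (rec_poly e' (Suc n)) E)\<^sup>2"
  obtain e' n where en: "e' = e \<and> n = m \<or> e' = e_rev \<and> n = N - 1 - m" "poly (rec_poly e' (Suc n)) z = 0"
    using assms(1) by (auto simp: poles_def)
  have nN: "n < N" using en(1) m by auto
  have nz: "poly (rec_poly e' (Suc n)) E \<noteq> 0" using assms(2) en(1) by (auto simp: poles_def)
  \<comment> \<open>\<open>rec_poly\<close> at index 1 is the constant 1 and has no root.\<close>
  have "n > 0" using en(2) by (cases n) auto
  have "(poly (rec_poly e' (Suc 0)) E)\<^sup>2 \<le> (\<Sum>i<n. (poly (rec_poly e' (Suc i)) E)\<^sup>2)"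
    using \<open>n > 0\<close> by (intro member_le_sum) auto
  then have "1 / (poly (rec_poly e' (Suc n)) E)\<^sup>2 \<le> ?s e' n"
    by (intro divide_right_mono) auto
  also have "\<dots> \<le> coupling_deriv E"
    unfolding coupling_deriv_def using en(1) by (auto simp: sum_nonneg)
  also have "\<dots> \<le> N" by fact
  finally have "1 \<le> N * (poly (rec_poly e' (Suc n)) E)\<^sup>2"
    using nz by (simp add: field_simps)
  also have "\<dots> \<le> N * (N * (poly (rec_poly e' (Suc n)) E)\<^sup>2)"
    using m by (intro mult_left_mono mult_right_mono[of 1 "real N", simplified]) auto
  finally have "1 \<le> (N * \<bar>poly (rec_poly e' (Suc n)) E\<bar>)\<^sup>2"
    by (simp add: power_mult_distrib power2_eq_square algebra_simps)
  then have "1 \<le> N * \<bar>poly (rec_poly e' (Suc n)) E\<bar>"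
    by (rule power2_le_imp_le[of 1, simplified]) simp
  then have "1 / N \<le> \<bar>poly (rec_poly e' (Suc n)) E\<bar>"
    using m by (simp add: field_simps)
  then show ?thesis using that en nN by blast
qed

text \<open>Mean value theorem between z, where the polynomial vanishes, and E, where it is at least
  1 / N in modulus. Intermediate points have modulus at most R + 1, and
  \<open>pderiv_rec_poly_le\<close> asks for one more unit; hence R + W + 2 \<le> K.\<close>

lemma dist_poles_lower_bound:
  fixes W R K :: real
  assumes e: "\<And>i. i < N \<Longrightarrow> i \<noteq> m \<Longrightarrow> \<bar>e i\<bar> \<le> W" and K: "R + W + 2 \<le> K" "1 \<le> K"
    and "\<bar>E\<bar> \<le> R" "z \<in> poles" "E \<notin> poles" "coupling_deriv E \<le> N" "\<bar>E - z\<bar> \<le> 1"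
  shows "1 / (N * (2 * K) ^ N) \<le> \<bar>E - z\<bar>"
proof -
  obtain e' n where n: "n < N" "e' = e \<and> n = m \<or> e' = e_rev \<and> n = N - 1 - m"
    and z: "poly (rec_poly e' (Suc n)) z = 0" and E: "1 / N \<le> \<bar>poly (rec_poly e' (Suc n)) E\<bar>"
    using coupling_deriv_root_bound assms by metis
  obtain y where y: "y \<in> {min z E..max z E}"
    "poly (rec_poly e' (Suc n)) E - poly (rec_poly e' (Suc n)) z = (E - z) * poly (pderiv (rec_poly e' (Suc n))) y"
    using poly_MVT'[of z E "{min z E..max z E}" "rec_poly e' (Suc n)"] by blast
  have "\<bar>y\<bar> \<le> R + 1" using y(1) assms(4,8) by (auto simp: min_def max_def split: if_splits)
  moreover have "\<bar>e' i\<bar> \<le> W" if "i < n" for i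
    using n that e[of i] e[of "N - 1 - i"] m by (auto simp: e_rev_def)
  ultimately have "\<bar>y - e' i\<bar> + 1 \<le> K" if "Suc i < Suc n" for i
    using that K(1) by (smt (verit) Suc_less_eq)
  then have "\<bar>poly (pderiv (rec_poly e' (Suc n))) y\<bar> \<le> (2 * K) ^ Suc n"
    using pderiv_rec_poly_le K(2) by blast
  also have "\<dots> \<le> (2 * K) ^ N" using n(1) K by (intro power_increasing) auto
  finally have "\<bar>poly (rec_poly e' (Suc n)) E\<bar> \<le> \<bar>E - z\<bar> * (2 * K) ^ N"
    using y(2) z by (simp add: abs_mult mult_left_mono)
  then have "1 / N \<le> \<bar>E - z\<bar> * (2 * K) ^ N" using E by linarith
  then show ?thesis using K(2) m by (simp add: field_simps)
qed

section \<open>Branches next to the poles and the dominating weight\<close>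

text \<open>For s = 1 the energies just above the pole z, for s = -1 those just below it, with no other
  pole in between.\<close>

definition branch :: "real \<Rightarrow> real \<Rightarrow> real \<Rightarrow> real set" where
  "branch R z s = {E. E \<notin> poles \<and> coupling_deriv E \<le> N \<and> \<bar>E\<bar> \<le> R \<and> 0 < s * (E - z) \<and> s * (E - z) \<le> 1 \<and>
     (\<forall>z'\<in>poles. \<not> (0 < s * (z' - z) \<and> s * (z' - z) < s * (E - z)))}"

lemma branch_borel: "branch R z s \<in> sets borel"
proof -
  have "poles \<in> sets borel" using finite_poles by (simp add: finite_imp_closed)
  note [measurable] = this
  have "branch R z s = {E\<in>space borel. E \<notin> poles \<and> coupling_deriv E \<le> N \<and> \<bar>E\<bar> \<le> R \<and> 0 < s * (E - z) \<and> s * (E - z) \<le> 1 \<and>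
     (\<forall>z'\<in>poles. \<not> (0 < s * (z' - z) \<and> s * (z' - z) < s * (E - z)))}"
    by (simp add: branch_def)
  also have "\<dots> \<in> sets borel"
    using finite_poles countable_finite[OF finite_poles] by measurable
  finally show ?thesis .
qed

text \<open>No pole lies between two points of a branch, so \<open>coupling\<close> is strictly
  increasing there.\<close>

lemma coupling_inj_on_branch:
  assumes "s \<in> {1, -1}"
  shows "inj_on coupling (branch R z s)"
proof (rule linorder_inj_onI)
  fix a b assume "a < b" "a \<in> branch R z s" "b \<in> branch R z s"
  then have "{a..b} \<inter> poles = {}"
    using assms by (force simp: branch_def)
  then show "coupling a \<noteq> coupling b" using coupling_strict_mono \<open>a < b\<close> by fastforce
qed auto

text \<open>The function 1 / |E - z| of the energy, transported to the variable t =
  \<open>coupling E\<close> along one branch and extended by 0.\<close>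

definition branch_weight :: "real \<Rightarrow> real \<Rightarrow> real \<Rightarrow> real \<Rightarrow> real" where
  "branch_weight R z s t = indicator (coupling ` branch R z s) t * (1 / \<bar>inv_into (branch R z s) coupling t - z\<bar>)"

lemma branch_weight_nonneg: "0 \<le> branch_weight R z s t"
  by (simp add: branch_weight_def)

lemma branch_weight_integral:
  fixes W R K :: real
  assumes e: "\<And>i. i < N \<Longrightarrow> i \<noteq> m \<Longrightarrow> \<bar>e i\<bar> \<le> W" and K: "R + W + 2 \<le> K" "1 \<le> K"
    and s: "s \<in> {1, -1}" and z: "z \<in> poles"
  shows "branch_weight R z s \<in> borel_measurable lebesgue"
    "(\<integral>\<^sup>+t. ennreal (branch_weight R z s t) \<partial>lebesgue) \<le> ennreal (N * ln (N * (2 * K) ^ N))"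
proof -
  \<comment> \<open>The lower bound of \<open>dist_poles_lower_bound\<close>: the branch stays at
    least \<eta> away from z.\<close>
  define \<eta> where "\<eta> = 1 / (N * (2 * K) ^ N)"
  have "1 * 1 \<le> N * (2 * K) ^ N"
    using m K(2) by (intro mult_mono one_le_power) auto
  then have \<eta>: "0 < \<eta>" "\<eta> \<le> 1" unfolding \<eta>_def by auto
  have sub: "branch R z s \<subseteq> (if s = 1 then {z + \<eta>..z + 1} else {z - 1..z - \<eta>})"
  proof
    fix E assume E: "E \<in> branch R z s"
    then have "\<bar>E - z\<bar> \<le> 1" using s by (auto simp: branch_def)
    then have "\<eta> \<le> \<bar>E - z\<bar>"
      unfolding \<eta>_def using E z by (intro dist_poles_lower_bound[OF e K]) (auto simp: branch_def)
    then show "E \<in> (if s = 1 then {z + \<eta>..z + 1} else {z - 1..z - \<eta>})"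
      using E s by (auto simp: branch_def)
  qed
  have bd: "\<bar>coupling_deriv E\<bar> \<le> N" if "E \<in> branch R z s" for E
    using that coupling_deriv_ge_1[of E] by (auto simp: branch_def)
  have der: "(coupling has_real_derivative coupling_deriv E) (at E)" if "E \<in> branch R z s" for E
    using that by (intro has_derivative_coupling) (simp add: branch_def)
  have I: "(if s = 1 then {z + \<eta>..z + 1} else {z - 1..z - \<eta>}) = {z + \<eta>..z + 1} \<or>
      (if s = 1 then {z + \<eta>..z + 1} else {z - 1..z - \<eta>}) = {z - 1..z - \<eta>}" by simp
  have "branch_weight R z s \<in> borel_measurable lebesgue \<and>
      (\<integral>\<^sup>+t. ennreal (branch_weight R z s t) \<partial>lebesgue) \<le> ennreal (N * ln (1 / \<eta>))"
    unfolding branch_weight_def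
    by (intro conjI nn_integral_inverse_dist_image[OF branch_borel coupling_deriv_measurable der coupling_inj_on_branch[OF s] bd _ \<eta> sub I])
      auto
  then show "branch_weight R z s \<in> borel_measurable lebesgue"
    "(\<integral>\<^sup>+t. ennreal (branch_weight R z s t) \<partial>lebesgue) \<le> ennreal (N * ln (N * (2 * K) ^ N))"
    unfolding \<eta>_def by auto
qed

text \<open>The selected eigenpair may depend on t in a non-measurable way. Summing over every pole
  and both sides gives a majorant independent of that selection.\<close>

definition weight :: "real \<Rightarrow> real \<Rightarrow> real" where
  "weight R t = (\<Sum>z\<in>poles. \<Sum>s\<in>{1, -1}. branch_weight R z s t)"

lemma weight_nonneg: "0 \<le> weight R t"
  by (simp add: weight_def sum_nonneg branch_weight_nonneg)

text \<open>There are at most 2 * N branches, each contributing at most N * ln (N * (2 * K) ^ N),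
  and ln N \<le> N bounds that logarithm by N * (1 + ln (2 * K)).\<close>

lemma weight_integral:
  fixes W R K :: real
  assumes e: "\<And>i. i < N \<Longrightarrow> i \<noteq> m \<Longrightarrow> \<bar>e i\<bar> \<le> W" and K: "R + W + 2 \<le> K" "1 \<le> K"
  shows "weight R \<in> borel_measurable lebesgue"
    "(\<integral>\<^sup>+t. ennreal (weight R t) \<partial>lebesgue) \<le> ennreal (2 * real N ^ 3 * (1 + ln (2 * K)))"
proof -
  let ?c = "N * ln (N * (2 * K) ^ N)"
  show "weight R \<in> borel_measurable lebesgue"
    unfolding weight_def[abs_def] by (intro borel_measurable_sum branch_weight_integral(1)[OF e K])
  have "1 * 1 \<le> N * (2 * K) ^ N"
    using m K(2) by (intro mult_mono one_le_power) auto
  then have c0: "0 \<le> ?c" by simp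
  have "?c \<le> N * (N * (1 + ln (2 * K)))"
  proof (rule mult_left_mono)
    have "ln N \<le> real N" using m ln_le_minus_one[of "real N"] by simp
    moreover have "ln (N * (2 * K) ^ N) = ln N + N * ln (2 * K)"
      using m K by (simp add: ln_mult ln_realpow algebra_simps)
    ultimately show "ln (N * (2 * K) ^ N) \<le> N * (1 + ln (2 * K))" by (simp add: algebra_simps)
  qed simp
  then have c: "real N * (2 * ?c) \<le> 2 * real N ^ 3 * (1 + ln (2 * K))"
    using mult_left_mono[of ?c "N * (N * (1 + ln (2 * K)))" "2 * real N"]
    by (simp add: power3_eq_cube algebra_simps)
  have "(\<integral>\<^sup>+t. ennreal (weight R t) \<partial>lebesgue) = (\<integral>\<^sup>+t. (\<Sum>z\<in>poles. \<Sum>s\<in>{1, -1}. ennreal (branch_weight R z s t)) \<partial>lebesgue)"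
    unfolding weight_def by (simp add: sum_ennreal branch_weight_nonneg sum_nonneg del: sum.insert)
  also have "\<dots> = (\<Sum>z\<in>poles. \<Sum>s\<in>{1, -1}. \<integral>\<^sup>+t. ennreal (branch_weight R z s t) \<partial>lebesgue)"
  proof -
    have meas: "(\<lambda>t. ennreal (branch_weight R z s t)) \<in> borel_measurable lebesgue" if "z \<in> poles" "s \<in> {1, -1}" for z s
      by (rule measurable_compose[OF branch_weight_integral(1)[OF e K that(2,1)] measurable_ennreal])
    show ?thesis
      by (subst nn_integral_sum, (intro borel_measurable_sum meas; assumption),
          intro sum.cong refl nn_integral_sum meas)
  qed
  also have "\<dots> \<le> (\<Sum>z\<in>poles. \<Sum>s\<in>{1, -1::real}. ennreal ?c)"
    by (intro sum_mono branch_weight_integral(2)[OF e K])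
  also have "\<dots> = ennreal (card poles * (2 * ?c))"
    using c0 by (simp add: ennreal_mult ennreal_of_nat_eq_real_of_nat mult.assoc)
  also have "\<dots> \<le> ennreal (2 * real N ^ 3 * (1 + ln (2 * K)))"
    using c0 card_poles by (intro ennreal_leI order_trans[OF _ c] mult_right_mono) auto
  finally show "(\<integral>\<^sup>+t. ennreal (weight R t) \<partial>lebesgue) \<le> ennreal (2 * real N ^ 3 * (1 + ln (2 * K)))" .
qed

text \<open>If some pole is closer than 1, the energy lies on a branch of the nearest pole, whose
  weight at t equals the inverse distance. Otherwise the summand 1 covers the bound.\<close>

lemma abs_deriv_u0_le_weight:
  assumes e: "\<And>i. i < N \<Longrightarrow> i \<noteq> m \<Longrightarrow> \<bar>e i\<bar> \<le> W" and t: "\<bar>t\<bar> \<le> W"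
    and sys: "anderson_eigensystem N (e(m := t)) E u"
    and k: "k < N" "1 / sqrt N \<le> \<bar>u k m\<bar>" and "x < N" "y < N"
  shows "\<bar>deriv_u0 N E u k x y\<bar> \<le> N * (1 + weight (W + 2) t)"
proof -
  have norm: "(\<Sum>x<N. (u n x)\<^sup>2) = 1" if "n < N" for n
    using sys that by (auto simp: anderson_eigensystem_def power2_eq_square)
  have eig: "eigenpair t (E n) (u n)" if "n < N" for n
    using sys that norm[OF that] by (simp add: anderson_eigensystem_def eigenpair_def)
  have "0 < 1 / sqrt N" using m by simp
  then have "u k m \<noteq> 0" using k(2) by linarith
  note Ek = eigenpair_coupling[OF eig[OF k(1)] this]
  have sep: "\<exists>z\<in>poles. \<bar>E k - z\<bar> \<le> \<bar>E k - E n\<bar>" if "n < N" "E n \<noteq> E k" for n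
    using eigenpair_separation[OF eig[OF k(1)] eig[OF that(1)] \<open>u k m \<noteq> 0\<close>] that(2) by auto
  have derN: "coupling_deriv (E k) \<le> N"
  proof -
    have "(1 / sqrt N)\<^sup>2 \<le> \<bar>u k m\<bar>\<^sup>2" using k(2) by (intro power_mono) auto
    then have "1 / N \<le> (u k m)\<^sup>2" by (simp add: power_divide)
    then show ?thesis using \<open>u k m \<noteq> 0\<close> m by (simp add: Ek(3) field_simps)
  qed
  have ER: "\<bar>E k\<bar> \<le> W + 2"
  proof (rule eigenvalue_abs_le)
    show "anderson_H N (e(m := t)) (u k) x = E k * u k x" if "x < N" for x
      using eig[OF k(1)] that by (simp add: eigenpair_def)
    show "\<bar>(e(m := t)) x\<bar> \<le> W" if "x < N" for x using e t that by simp
  qed (use norm k in auto)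
  show ?thesis
  proof (cases "\<forall>z\<in>poles. 1 \<le> \<bar>E k - z\<bar>")
    case True
    have "\<bar>deriv_u0 N E u k x y\<bar> \<le> N * (1 / 1)"
      using sep True norm assms by (intro abs_deriv_u0_le) force+
    also have "\<dots> \<le> N * (1 + weight (W + 2) t)"
      using weight_nonneg by (intro mult_left_mono) auto
    finally show ?thesis .
  next
    case False
    then have "poles \<noteq> {}" by auto
    \<comment> \<open>By minimality no pole lies strictly between this one and \<open>E k\<close>,
      as \<open>branch\<close> demands.\<close>
    define z where "z = arg_min_on (\<lambda>z. \<bar>E k - z\<bar>) poles"
    have z: "z \<in> poles" using finite_poles \<open>poles \<noteq> {}\<close> unfolding z_def by (rule arg_min_if_finite)
    have min: "\<bar>E k - z\<bar> \<le> \<bar>E k - z'\<bar>" if "z' \<in> poles" for z'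
      using arg_min_least[OF finite_poles \<open>poles \<noteq> {}\<close> that] unfolding z_def .
    have lt: "\<bar>E k - z\<bar> < 1" using False min by force
    have ne: "E k \<noteq> z" using z Ek(1) by auto
    define s :: real where "s = (if z < E k then 1 else -1)"
    have s: "s \<in> {1, -1}" by (simp add: s_def)
    have sabs: "s * (E k - z) = \<bar>E k - z\<bar>" using ne by (simp add: s_def)
    have in_branch: "E k \<in> branch (W + 2) z s"
      unfolding branch_def sabs using Ek(1) derN ER ne lt min
      by (auto simp: s_def split: if_splits) (smt (verit))+
    have "\<bar>deriv_u0 N E u k x y\<bar> \<le> N * (1 / \<bar>E k - z\<bar>)"
    proof (rule abs_deriv_u0_le)
      show "\<bar>E k - z\<bar> \<le> \<bar>E k - E n\<bar>" if "n < N" "E n \<noteq> E k" for n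
        using sep[OF that] min by (blast intro: order_trans)
    qed (use norm ne assms in auto)
    \<comment> \<open>Since t = \<open>coupling (E k)\<close> and \<open>coupling\<close> is
      injective on the branch, \<open>inv_into\<close> returns \<open>E k\<close>.\<close>
    also have "1 / \<bar>E k - z\<bar> = branch_weight (W + 2) z s t"
      using in_branch coupling_inj_on_branch[OF s] by (simp add: branch_weight_def flip: Ek(2))
    also have "\<dots> \<le> (\<Sum>s\<in>{1, -1}. branch_weight (W + 2) z s t)"
      using s branch_weight_nonneg by (intro member_le_sum) auto
    also have "\<dots> \<le> weight (W + 2) t"
      unfolding weight_def using z finite_poles by (intro member_le_sum sum_nonneg) (auto simp: branch_weight_nonneg)
    also have "weight (W + 2) t \<le> 1 + weight (W + 2) t" by simp
    finally show ?thesis by (simp add: mult_left_mono)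
  qed
qed

end

section \<open>Averaging over the potential\<close>

theorem theorem13:
  fixes rho :: "real \<Rightarrow> real" and W :: real
  assumes "rho \<in> borel_measurable borel"
    and "\<forall>t. 0 \<le> rho t"
    and "\<exists>C. \<forall>t. rho t \<le> C"
    and "\<forall>t. t \<notin> {0..W} \<longrightarrow> rho t = 0"
    and "(\<integral>\<^sup>+ t. ennreal (rho t) \<partial>lborel) = 1"
  shows "\<exists>B::real. \<forall>N m x y (EU :: (nat \<Rightarrow> real) \<Rightarrow> (nat \<Rightarrow> real) \<times> (nat \<Rightarrow> nat \<Rightarrow> real))
            (k :: (nat \<Rightarrow> real) \<Rightarrow> nat).
     m < N \<and> x < N \<and> y < N \<and>
     (\<forall>eps \<in> space (anderson_measure N rho).
        anderson_eigensystem N eps (fst (EU eps)) (snd (EU eps)) \<and> k eps < N \<and>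
        \<bar>snd (EU eps) (k eps) m\<bar> \<ge> 1 / sqrt (real N))
     \<longrightarrow> (\<integral>\<^sup>+ eps. ennreal \<bar>deriv_u0 N (fst (EU eps)) (snd (EU eps)) (k eps) x y\<bar>
             \<partial>anderson_measure N rho) \<le> ennreal (B * real N powr (11/2))"
proof -
  note [measurable] = assms(1)
  obtain C where C: "\<And>t. rho t \<le> C" using assms(3) by blast
  have "0 \<le> C" using C[of 0] assms(2) by (meson order_trans)
  have "0 \<le> W"
  proof (rule ccontr)
    assume "\<not> 0 \<le> W"
    then have "rho t = 0" for t using assms(4) by simp
    then show False using assms(5) by simp
  qed
  define M where "M = density lborel (\<lambda>t. ennreal (rho t))"
  have "emeasure M (space M) = 1"
    using assms(5) by (simp add: M_def emeasure_density)
  then have "prob_space M" by (rule prob_spaceI)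
  have AE_M: "AE t in M. t \<in> {0..W}"
  proof -
    have "t \<in> {0..W}" if "0 < ennreal (rho t)" for t using that assms(4) by force
    then show ?thesis unfolding M_def by (subst AE_density) auto
  qed
  \<comment> \<open>R = W + 2 bounds the eigenvalues, and K = R + W + 2.\<close>
  define K where "K = 2 * W + 4"
  have K: "W + 2 + W + 2 \<le> K" "1 \<le> K" using \<open>0 \<le> W\<close> by (simp_all add: K_def)
  then have ln0: "0 \<le> ln (2 * K)" by simp
  \<comment> \<open>The 1 stems from energies at distance at least 1 from all poles, the other term
    from C times the integral of the weight.\<close>
  define B where "B = 1 + 2 * C * (1 + ln (2 * K))"
  have "(\<integral>\<^sup>+ eps. ennreal \<bar>deriv_u0 N (fst (EU eps)) (snd (EU eps)) (k eps) x y\<bar>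
             \<partial>anderson_measure N rho) \<le> ennreal (B * real N powr (11/2))"
    if mxy: "m < N" "x < N" "y < N" and EU: "\<forall>eps \<in> space (anderson_measure N rho).
        anderson_eigensystem N eps (fst (EU eps)) (snd (EU eps)) \<and> k eps < N \<and>
        \<bar>snd (EU eps) (k eps) m\<bar> \<ge> 1 / sqrt (real N)"
    for N m x y and EU :: "(nat \<Rightarrow> real) \<Rightarrow> (nat \<Rightarrow> real) \<times> (nat \<Rightarrow> nat \<Rightarrow> real)"
      and k :: "(nat \<Rightarrow> real) \<Rightarrow> nat"
  proof -
    let ?F = "\<lambda>eps. \<bar>deriv_u0 N (fst (EU eps)) (snd (EU eps)) (k eps) x y\<bar>"
    let ?J = "{..<N} - {m}"
    have fiber: "(\<integral>\<^sup>+t. ennreal (?F (w(m := t))) \<partial>M) \<le> ennreal (B * real N ^ 4)"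
      if w: "w \<in> space (PiM ?J (\<lambda>_. M))" "\<forall>j\<in>?J. w j \<in> {0..W}" for w
    proof -
      interpret anderson_site N m w by standard fact
      let ?c = "2 * real N ^ 3 * (1 + ln (2 * K))"
      have wW: "\<bar>w i\<bar> \<le> W" if "i < N" "i \<noteq> m" for i using w(2) that by auto
      note weight_bound = weight_integral[OF wW K]
      note [measurable] = weight_bound(1)
      have rho_leb [measurable]: "rho \<in> borel_measurable lebesgue"
        by (simp add: measurable_completion)
      have F: "?F (w(m := t)) \<le> N * (1 + weight (W + 2) t)" if "t \<in> {0..W}" for t
      proof (rule abs_deriv_u0_le_weight[OF wW])
        have "w(m := t) \<in> space (anderson_measure N rho)"
          using w(1) mxy(1) by (auto simp: anderson_measure_def space_PiM M_def PiE_def extensional_def)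
        then show "anderson_eigensystem N (w(m := t)) (fst (EU (w(m := t)))) (snd (EU (w(m := t))))"
          "k (w(m := t)) < N" "1 / sqrt N \<le> \<bar>snd (EU (w(m := t))) (k (w(m := t))) m\<bar>"
          using EU by auto
      qed (use that mxy in auto)
      \<comment> \<open>Only the weight term trades \<open>rho t\<close> for C; the other keeps it
        and integrates to N.\<close>
      have pt: "rho t * ?F (w(m := t)) \<le> N * rho t + N * C * weight (W + 2) t" for t
      proof (cases "t \<in> {0..W}")
        case True
        have "rho t * ?F (w(m := t)) \<le> rho t * (N * (1 + weight (W + 2) t))"
          using F[OF True] assms(2) by (intro mult_left_mono) auto
        also have "\<dots> = N * rho t + rho t * (N * weight (W + 2) t)" by (simp add: algebra_simps)
        also have "\<dots> \<le> N * rho t + C * (N * weight (W + 2) t)"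
          using C weight_nonneg by (intro add_left_mono mult_right_mono) auto
        finally show ?thesis by (simp add: algebra_simps)
      next
        case False
        then show ?thesis using assms(4) weight_nonneg \<open>0 \<le> C\<close> by simp
      qed
      have "(\<integral>\<^sup>+t. ennreal (?F (w(m := t))) \<partial>M) \<le> (\<integral>\<^sup>+t. ennreal (rho t) * ennreal (?F (w(m := t))) \<partial>lborel)"
        unfolding M_def by (rule nn_integral_density_le) simp
      \<comment> \<open>\<open>weight\<close> is only known to be Lebesgue measurable, so the
        integral moves to the completion, which leaves its value unchanged.\<close>
      also have "\<dots> = (\<integral>\<^sup>+t. ennreal (rho t) * ennreal (?F (w(m := t))) \<partial>lebesgue)"
        by (simp add: nn_integral_completion)
      also have "\<dots> \<le> (\<integral>\<^sup>+t. ennreal N * ennreal (rho t) + ennreal (N * C) * ennreal (weight (W + 2) t) \<partial>lebesgue)"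
        using pt assms(2) \<open>0 \<le> C\<close> weight_nonneg
        by (intro nn_integral_mono) (simp add: ennreal_mult[symmetric] ennreal_plus[symmetric] ennreal_leI del: ennreal_plus)
      also have "\<dots> = ennreal N * (\<integral>\<^sup>+t. ennreal (rho t) \<partial>lebesgue)
          + ennreal (N * C) * (\<integral>\<^sup>+t. ennreal (weight (W + 2) t) \<partial>lebesgue)"
        by (simp add: nn_integral_add nn_integral_cmult)
      also have "\<dots> \<le> ennreal N * 1 + ennreal (N * C) * ennreal ?c"
        using weight_bound(2) assms(5) by (intro add_mono mult_left_mono) (simp_all add: nn_integral_completion)
      also have "\<dots> = ennreal (N + N * C * ?c)"
        using \<open>0 \<le> C\<close> ln0 by (simp add: ennreal_mult[symmetric] ennreal_plus[symmetric] del: ennreal_plus)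
      also have "\<dots> \<le> ennreal (B * real N ^ 4)"
      proof (rule ennreal_leI)
        have "real N * 1 \<le> real N * real N ^ 3" using mxy by (intro mult_left_mono one_le_power) auto
        then show "N + N * C * ?c \<le> B * real N ^ 4"
          by (simp add: B_def algebra_simps power_numeral_reduce)
      qed
      finally show ?thesis .
    qed
    have "insert m ?J = {..<N}" using mxy by auto
    then have meas: "anderson_measure N rho = PiM (insert m ?J) (\<lambda>_. M)"
      unfolding anderson_measure_def M_def by simp
    have "(\<integral>\<^sup>+eps. ennreal (?F eps) \<partial>anderson_measure N rho) \<le> ennreal (B * real N ^ 4)"
      unfolding meas by (rule nn_integral_PiM_fiber_le[OF \<open>prob_space M\<close> _ _ AE_M fiber]) simp_all
    also have "\<dots> \<le> ennreal (B * real N powr (11/2))"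
    proof (intro ennreal_leI mult_left_mono)
      have "real N ^ 4 = real N powr 4" using mxy by (simp add: powr_numeral)
      also have "\<dots> \<le> real N powr (11/2)" using mxy by (intro powr_mono) auto
      finally show "real N ^ 4 \<le> real N powr (11/2)" .
    qed (use \<open>0 \<le> C\<close> ln0 in \<open>simp add: B_def\<close>)
    finally show ?thesis .
  qed
  then show ?thesis by blast
qed

end
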